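(* Let $\alpha>0$, $\lambda\in\mathbb{R}$, $t_0<T$, let $K\ge1$ be an integer, let $f\in C^{K+1}([t_0,T])$, and let $c_1,\dots,c_K\in[0,1]$ be $K$ distinct nodes, with weights $b_1,\dots,b_K$ such that for every step-size $h>0$ and all $0\le j\le n-1$ $$\sum_{r=1}^{K} b_r(n-j)\,c_r^k=k!\,h^\alpha R_{\alpha,\alpha,k}(n-j,0,1;h^\alpha\lambda),\qquad k=0,1,\dots,K-1 .$$ Then the method $$y_n=\sum_{k=0}^{m-1}e_{\alpha,k+1}(t_n-t_0;\lambda)\,y_{0,k}+\sum_{j=0}^{n-1}\sum_{r=1}^{K}b_r(n-j)\,f(t_j+c_rh)$$ converges with order $K$, i.e. $y(t_n)-y_n=\mathcal{O}(h^K)$ as $h\to0$ with $t_n=t_0+nh\in(t_0,T]$ held fixed. Moreover, if the nodes are chosen such that $P_K:=\int_0^1(u-c_1)\cdots(u-c_K)\,du=0$, then the order of convergence is $K+\min\{\alpha,1\}$, i.e. $y(t_n)-y_n=\mathcal{O}(h^{K+\min\{\alpha,1\}})$ as $h\to0$ with $t_n$ held fixed.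
   Context: $E_{\alpha,\beta}(z)=\sum_{k=0}^\infty \frac{z^k}{\Gamma(\alpha k+\beta)}$ is the Mittag--Leffler function and $e_{\alpha,\beta}(t;z)=t^{\beta-1}E_{\alpha,\beta}(-t^\alpha z)$. For $a<b\le t$ and an integer $k\ge0$, $R_{\alpha,\beta,k}(t,a,b;z)=\frac{1}{\Gamma(k+1)}\int_a^b e_{\alpha,\beta}(t-s;z)(s-a)^k\,ds$. Convention: $0^0=1$. The mesh is $t_i=t_0+ih$; the weights $b_r(n-j)$ are real and depend on $\alpha,\lambda,h$, while the nodes do not depend on $h$. Let $m=\lceil\alpha\rceil$ and let $y_{0,0},\dots,y_{0,m-1}\in\mathbb{R}$ be given initial data. The function $y$ is the solution on $[t_0,T]$ of the linear fractional differential equation $D^\alpha_{t_0}y(t)+\lambda y(t)=f(t)$ (Caputo derivative of order $\alpha$ with origin $t_0$), $y^{(k)}(t_0)=y_{0,k}$ for $k=0,\dots,m-1$, that is, the function given by $$y(t)=\sum_{k=0}^{m-1}e_{\alpha,k+1}(t-t_0;\lambda)\,y_{0,k}+\int_{t_0}^t e_{\alpha,\alpha}(t-s;\lambda)f(s)\,ds .$$ A method converges with order $p$ if $y(t_n)-y_n=\mathcal{O}(h^p)$ as $h\to0$. *)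

theory Defs
  imports "HOL-Analysis.Analysis" "HOL-Library.Landau_Symbols"
begin

definition mittag_leffler :: "real \<Rightarrow> real \<Rightarrow> real \<Rightarrow> real" where
  "mittag_leffler \<alpha> \<beta> z = (\<Sum>k. z ^ k / Gamma (\<alpha> * real k + \<beta>))"

(* The case distinction implements the convention 0^0 = 1 for t^(\<beta>-1);
   the library's powr has 0 powr 0 = 0. The factor t^\<alpha> needs no such treatment,
   as \<alpha> > 0 throughout. *)
definition ml_kernel :: "real \<Rightarrow> real \<Rightarrow> real \<Rightarrow> real \<Rightarrow> real" where
  "ml_kernel \<alpha> \<beta> t z =
     (if t = 0 \<and> \<beta> = 1 then 1 else t powr (\<beta> - 1)) * mittag_leffler \<alpha> \<beta> (- (t powr \<alpha>) * z)"

definition ml_R :: "real \<Rightarrow> real \<Rightarrow> nat \<Rightarrow> real \<Rightarrow> real \<Rightarrow> real \<Rightarrow> real \<Rightarrow> real" where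
  "ml_R \<alpha> \<beta> k t a b z =
     1 / Gamma (real k + 1) * integral {a..b} (\<lambda>s. ml_kernel \<alpha> \<beta> (t - s) z * (s - a) ^ k)"

(* n-fold continuous differentiability on S, with derivatives taken relative to S
   (one-sided at the endpoints when S is a compact interval). *)
definition Ck_on :: "nat \<Rightarrow> (real \<Rightarrow> real) \<Rightarrow> real set \<Rightarrow> bool" where
  "Ck_on n f S \<longleftrightarrow>
     (\<exists>D :: nat \<Rightarrow> real \<Rightarrow> real. D 0 = f \<and>
        (\<forall>k<n. \<forall>x\<in>S. (D k has_real_derivative D (Suc k) x) (at x within S)) \<and>
        continuous_on S (D n))"

(* Solution of the Caputo problem D^\<alpha> y + lam y = f with y^(k)(t0) = y0 k for k < \<lceil>\<alpha>\<rceil>,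
   given by the variation-of-constants formula. *)
definition fde_solution ::
  "real \<Rightarrow> real \<Rightarrow> real \<Rightarrow> (nat \<Rightarrow> real) \<Rightarrow> (real \<Rightarrow> real) \<Rightarrow> real \<Rightarrow> real" where
  "fde_solution \<alpha> lam t0 y0 f t =
     (\<Sum>k<nat \<lceil>\<alpha>\<rceil>. ml_kernel \<alpha> (real k + 1) (t - t0) lam * y0 k) +
     integral {t0..t} (\<lambda>s. ml_kernel \<alpha> \<alpha> (t - s) lam * f s)"

(* The weight b_r(i) for step-size h is b h r i. *)
definition quadrature_method ::
  "real \<Rightarrow> real \<Rightarrow> real \<Rightarrow> (nat \<Rightarrow> real) \<Rightarrow> (real \<Rightarrow> real) \<Rightarrow> nat \<Rightarrow> (nat \<Rightarrow> real) \<Rightarrow>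
   (real \<Rightarrow> nat \<Rightarrow> nat \<Rightarrow> real) \<Rightarrow> real \<Rightarrow> nat \<Rightarrow> real" where
  "quadrature_method \<alpha> lam t0 y0 f K c b h n =
     (\<Sum>k<nat \<lceil>\<alpha>\<rceil>. ml_kernel \<alpha> (real k + 1) ((t0 + real n * h) - t0) lam * y0 k) +
     (\<Sum>j<n. \<Sum>r = 1..K. b h r (n - j) * f ((t0 + real j * h) + c r * h))"

(* y h n is the approximation at t0 + n h. Holding t = t0 + n h in (t0, T] fixed while
   h \<rightarrow> 0 means h = (t - t0) / n with n \<rightarrow> \<infinity>; the O-constant may depend on t. *)
definition converges_with_order ::
  "real \<Rightarrow> real \<Rightarrow> (real \<Rightarrow> real) \<Rightarrow> (real \<Rightarrow> nat \<Rightarrow> real) \<Rightarrow> real \<Rightarrow> bool" where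
  "converges_with_order t0 T Y y p \<longleftrightarrow>
     (\<forall>t\<in>{t0<..T}.
        (\<lambda>n. Y t - y ((t - t0) / real n) n) \<in> O[sequentially](\<lambda>n. ((t - t0) / real n) powr p))"

end

theory Submission
  imports Defs "HOL-Real_Asymp.Real_Asymp"
begin

text \<open>
  The kernel \<open>v(s) = e(t - s)\<close> has the form \<open>(t - s)^(\<alpha> - 1) F((t - s)^\<alpha>)\<close> with \<open>F\<close> entire. By the scaling of
  the kernel, the weight conditions say that on each mesh interval the rule integrates \<open>v\<close> times
  polynomials of degree below \<open>K\<close> exactly. Expanding \<open>f\<close> at the left end point \<open>a\<close> of the interval
  to order \<open>K\<close> leaves a local error \<open>f^(K)(a)/K! h^K Q\<close> with \<open>Q\<close> the integral of \<open>v\<close> against the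
  nodal polynomial, up to \<open>O(h^(K+1))\<close> times the integral of \<open>|v|\<close>; the weights are controlled through
  the Lagrange basis. The moments \<open>Q\<close> sum to \<open>O(1)\<close>, which gives order \<open>K\<close>. If the nodal polynomial has
  mean zero, \<open>v\<close> may be replaced by \<open>v - v(a)\<close> in \<open>Q\<close>; away from \<open>t\<close> the oscillations of \<open>v\<close> telescope,
  since the two powers involved are monotone, and the interval next to \<open>t\<close> contributes \<open>O(h^\<alpha>)\<close>.
  Hence the moments sum to \<open>O(h^min(\<alpha>,1))\<close>.
\<close>

section \<open>The Mittag-Leffler function\<close>

text \<open>Euler's integral is cut down to \<open>{R..R+1}\<close>, where the integrand is at least
  its smallest power times its smallest exponential. As \<open>R\<close> is free, Gamma outgrows
  every geometric sequence, and Stirling's formula can be avoided.\<close>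

lemma Gamma_ge_powr:
  fixes x R :: real
  assumes "x \<ge> 1" "R > 0"
  shows "R powr (x - 1) * exp (- (R + 1)) \<le> Gamma x"
proof -
  let ?g = "\<lambda>t::real. t powr (x - 1) / exp t"
  have G: "(?g has_integral Gamma x) {0..}"
    using assms by (intro Gamma_integral_real) auto
  have I: "?g integrable_on {R..R+1}"
    using assms by (intro integrable_continuous_real continuous_intros) auto
  have "R powr (x - 1) * exp (- (R + 1)) = integral {R..R+1} (\<lambda>_. R powr (x - 1) * exp (- (R + 1)))"
    by simp
  also have "\<dots> \<le> integral {R..R+1} ?g"
  proof (rule integral_le)
    fix t assume t: "t \<in> {R..R+1}"
    have "R powr (x - 1) * exp (- (R + 1)) \<le> t powr (x - 1) * exp (- t)"
      using t assms by (intro mult_mono powr_mono2) auto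
    then show "R powr (x - 1) * exp (- (R + 1)) \<le> ?g t" by (simp add: exp_minus field_simps)
  qed (use I in auto)
  also have "\<dots> \<le> Gamma x"
    using has_integral_subset_le[OF _ integrable_integral[OF I] G] assms by auto
  finally show ?thesis .
qed

text \<open>Since \<open>\<alpha> > 0\<close>, the Gamma argument eventually exceeds 1, and from
  there the lower bound on Gamma yields a geometric majorant. The finitely many earlier terms,
  possibly at poles of Gamma, do not affect summability.\<close>

lemma summable_mittag_leffler:
  fixes \<alpha> \<beta> z :: real
  assumes "\<alpha> > 0"
  shows "summable (\<lambda>k. inverse (Gamma (\<alpha> * real k + \<beta>)) * z ^ k)"
proof (rule summable_comparison_test_ev)
  \<comment> \<open>This \<open>R\<close> makes \<open>R powr \<alpha>\<close> larger than twice
    \<open>\<bar>z\<bar>\<close>, which produces the ratio 1/2; the summand 1 keeps \<open>R\<close>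
    positive when \<open>z = 0\<close>.\<close>
  define R where "R = (2 * \<bar>z\<bar> + 1) powr (1 / \<alpha>)"
  have R: "R > 0" and Ra: "R powr \<alpha> = 2 * \<bar>z\<bar> + 1"
    using assms by (auto simp: R_def powr_powr)
  \<comment> \<open>\<open>C\<close> collects the factors of the Gamma bound that do not depend on
    \<open>k\<close>.\<close>
  define C where "C = exp (R + 1) * R powr (1 - \<beta>)"
  show "summable (\<lambda>k. C * (1/2) ^ k)" by (intro summable_mult summable_geometric) auto
  have "\<forall>\<^sub>F k in sequentially. \<alpha> * real k + \<beta> \<ge> 1"
    using assms by real_asymp
  then show "\<forall>\<^sub>F k in sequentially. norm (inverse (Gamma (\<alpha> * real k + \<beta>)) * z ^ k) \<le> C * (1/2) ^ k"
  proof eventually_elim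
    fix k :: nat assume k: "1 \<le> \<alpha> * real k + \<beta>"
    define x where "x = \<alpha> * real k + \<beta>"
    have "R powr (x - 1) = (R powr \<alpha>) powr real k / R powr (1 - \<beta>)"
      unfolding x_def powr_powr powr_diff[symmetric] by (simp add: algebra_simps)
    then have eq: "R powr (x - 1) = (2 * \<bar>z\<bar> + 1) ^ k / R powr (1 - \<beta>)"
      unfolding Ra using powr_realpow[of "2 * \<bar>z\<bar> + 1" k] by simp
    have "(2 * \<bar>z\<bar> + 1) ^ k / C = R powr (x - 1) * exp (- (R + 1))"
      unfolding eq C_def exp_minus by (simp add: field_simps)
    also have "\<dots> \<le> Gamma x" using k R by (intro Gamma_ge_powr) (auto simp: x_def)
    finally have G: "(2 * \<bar>z\<bar> + 1) ^ k / C \<le> Gamma x" .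
    have C: "C > 0" using R by (simp add: C_def)
    have P: "(2 * \<bar>z\<bar> + 1) ^ k > 0" by simp
    have "\<bar>z\<bar> ^ k * 2 ^ k \<le> (2 * \<bar>z\<bar> + 1) ^ k"
      unfolding power_mult_distrib[symmetric] by (intro power_mono) auto
    have "inverse (Gamma x) \<le> inverse ((2 * \<bar>z\<bar> + 1) ^ k / C)"
      using G C P by (intro le_imp_inverse_le) auto
    also have "\<dots> = C / (2 * \<bar>z\<bar> + 1) ^ k" by simp
    finally have "inverse (Gamma x) * \<bar>z\<bar> ^ k \<le> C / (2 * \<bar>z\<bar> + 1) ^ k * \<bar>z\<bar> ^ k"
      by (rule mult_right_mono) auto
    also have "\<dots> \<le> C * (1/2) ^ k"
      using C P \<open>\<bar>z\<bar> ^ k * 2 ^ k \<le> (2 * \<bar>z\<bar> + 1) ^ k\<close> by (simp add: field_simps)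
    finally show "norm (inverse (Gamma (\<alpha> * real k + \<beta>)) * z ^ k) \<le> C * (1/2) ^ k"
      using k Gamma_real_pos[of x] unfolding x_def by (simp add: abs_mult power_abs)
  qed
qed

text \<open>A power series that converges everywhere may be differentiated termwise, and the derived
  series converges everywhere again. Hence \<open>D\<close> is itself differentiable and therefore
  continuous.\<close>

lemma mittag_leffler_C1:
  assumes "\<alpha> > 0"
  obtains D where "\<And>z. (mittag_leffler \<alpha> \<beta> has_real_derivative D z) (at z)" "continuous_on UNIV D"
proof -
  let ?c = "\<lambda>k. inverse (Gamma (\<alpha> * real k + \<beta>))"
  have S: "summable (\<lambda>k. ?c k * z ^ k)" for z using summable_mittag_leffler[OF assms] .
  have S': "summable (\<lambda>k. diffs ?c k * z ^ k)" for z
    by (rule termdiff_converges_all) (rule S)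
  have eq: "mittag_leffler \<alpha> \<beta> = (\<lambda>z. \<Sum>k. ?c k * z ^ k)"
    by (auto simp: mittag_leffler_def fun_eq_iff field_simps)
  have "(mittag_leffler \<alpha> \<beta> has_real_derivative (\<Sum>n. diffs ?c n * z^n)) (at z)" for z
    unfolding eq by (rule termdiffs_strong_converges_everywhere) (rule S)
  moreover have "continuous_on UNIV (\<lambda>z. \<Sum>n. diffs ?c n * z^n)"
    using termdiffs_strong_converges_everywhere[OF S']
    by (meson DERIV_isCont continuous_at_imp_continuous_on)
  ultimately show ?thesis by (rule that)
qed

lemma continuous_on_mittag_leffler:
  assumes "\<alpha> > 0"
  shows "continuous_on UNIV (mittag_leffler \<alpha> \<beta>)"
  using mittag_leffler_C1[OF assms] by (metis DERIV_continuous_on has_field_derivative_at_within)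

text \<open>Compactness bounds the function and its derivative, and the mean value inequality gives
  \<open>\<Lambda>\<close>. The variable \<open>x\<close> stands for
  \<open>(t - s) powr \<alpha>\<close>: for \<open>\<alpha> < 1\<close> this power is not Lipschitz
  in \<open>s\<close> at \<open>s = t\<close>, so the Lipschitz bound is stated in
  \<open>x\<close>.\<close>

lemma mittag_leffler_bounded_lipschitz:
  assumes "\<alpha> > 0"
  obtains B \<Lambda> where "B \<ge> 0" "\<Lambda> \<ge> 0"
    "\<And>x. x \<in> {0..A} \<Longrightarrow> \<bar>mittag_leffler \<alpha> \<beta> (- x * lam)\<bar> \<le> B"
    "\<And>x y. x \<in> {0..A} \<Longrightarrow> y \<in> {0..A} \<Longrightarrow>
       \<bar>mittag_leffler \<alpha> \<beta> (- x * lam) - mittag_leffler \<alpha> \<beta> (- y * lam)\<bar> \<le> \<Lambda> * \<bar>x - y\<bar>"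
proof -
  obtain D where D: "\<And>z. (mittag_leffler \<alpha> \<beta> has_real_derivative D z) (at z)" "continuous_on UNIV D"
    using mittag_leffler_C1[OF assms] by blast
  let ?F = "\<lambda>x. mittag_leffler \<alpha> \<beta> (- x * lam)" and ?D = "\<lambda>x. D (- x * lam) * (- lam)"
  have dF: "(?F has_real_derivative ?D x) (at x within {0..A})" for x
    by (rule DERIV_chain2[OF D(1)]) (auto intro!: derivative_eq_intros)
  have cF: "continuous_on {0..A} ?F" by (rule DERIV_continuous_on) (rule dF)
  have cD: "continuous_on {0..A} ?D"
    by (rule continuous_on_mult[OF continuous_on_compose2[OF D(2)]]) (auto intro!: continuous_intros)
  obtain B where B: "B > 0" "\<And>x. x \<in> {0..A} \<Longrightarrow> norm (?F x) \<le> B"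
    using compact_imp_bounded[OF compact_continuous_image[OF cF compact_Icc]]
    unfolding bounded_pos by auto
  obtain L where L: "L > 0" "\<And>x. x \<in> {0..A} \<Longrightarrow> norm (?D x) \<le> L"
    using compact_imp_bounded[OF compact_continuous_image[OF cD compact_Icc]]
    unfolding bounded_pos by auto
  show ?thesis
  proof (rule that[of B L])
    fix x y assume "x \<in> {0..A}" "y \<in> {0..A}"
    then have "norm (?F x - ?F y) \<le> L * norm (x - y)"
      by (intro field_differentiable_bound[OF _ dF]) (use L in auto)
    then show "\<bar>?F x - ?F y\<bar> \<le> L * \<bar>x - y\<bar>" by simp
  qed (use B L in auto)
qed

section \<open>Interpolatory quadrature with an integrable weight\<close>

lemma absolutely_integrable_continuous_mult:
  fixes v g :: "real \<Rightarrow> real"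
  assumes "v absolutely_integrable_on {a..b}" "continuous_on {a..b} g"
  shows "(\<lambda>s. v s * g s) absolutely_integrable_on {a..b}"
proof -
  have "(\<lambda>s. g s * v s) absolutely_integrable_on {a..b}"
    using assms
    by (intro absolutely_integrable_bounded_measurable_product_real
          continuous_imp_measurable_on_sets_lebesgue compact_imp_bounded compact_continuous_image) auto
  then show ?thesis by (simp add: mult.commute)
qed

text \<open>Hoelder's inequality for L1 and L-infinity: a singularity of \<open>v\<close> enters
  only through the integral of its absolute value.\<close>

lemma abs_integral_mult_le:
  fixes v g :: "real \<Rightarrow> real"
  assumes "v absolutely_integrable_on {a..b}" "continuous_on {a..b} g"
    and "\<And>s. s \<in> {a..b} \<Longrightarrow> \<bar>g s\<bar> \<le> M"
  shows "\<bar>integral {a..b} (\<lambda>s. v s * g s)\<bar> \<le> M * integral {a..b} (\<lambda>s. \<bar>v s\<bar>)"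
proof -
  have v: "(\<lambda>s. \<bar>v s\<bar>) integrable_on {a..b}"
    using assms(1) by (simp add: absolutely_integrable_on_def)
  have "norm (integral {a..b} (\<lambda>s. v s * g s)) \<le> integral {a..b} (\<lambda>s. M * \<bar>v s\<bar>)"
  proof (rule integral_norm_bound_integral)
    show "(\<lambda>s. v s * g s) integrable_on {a..b}"
      using absolutely_integrable_continuous_mult[OF assms(1,2)]
      by (rule set_lebesgue_integral_eq_integral(1))
    show "(\<lambda>s. M * \<bar>v s\<bar>) integrable_on {a..b}" using v by (rule integrable_on_mult_right)
    show "norm (v s * g s) \<le> M * \<bar>v s\<bar>" if "s \<in> {a..b}" for s
      using mult_left_mono[OF assms(3)[OF that], of "\<bar>v s\<bar>"] by (simp add: abs_mult mult.commute)
  qed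
  then show ?thesis by simp
qed

text \<open>The product over the other nodes, divided by its value at \<open>c r\<close>, which is
  nonzero because the nodes are distinct.\<close>

lemma lagrange_basis_exists:
  fixes c :: "'a \<Rightarrow> 'b::field"
  assumes "finite A" "inj_on c A" "r \<in> A"
  shows "\<exists>p. degree p < card A \<and> (\<forall>s\<in>A. poly p (c s) = (if s = r then 1 else 0))"
proof (intro exI conjI ballI)
  define q where "q = (\<Prod>s\<in>A - {r}. [:- c s, 1:])"
  have ne: "poly q (c r) \<noteq> 0"
    using assms by (auto simp: q_def poly_prod inj_on_def)
  let ?p = "smult (inverse (poly q (c r))) q"
  have "degree q = card (A - {r})" unfolding q_def by (subst degree_prod_sum_eq) auto
  also have "\<dots> < card A" using assms by (intro psubset_card_mono) auto
  finally show "degree ?p < card A" using le_less_trans[OF degree_smult_le] by blast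
  fix s assume "s \<in> A"
  then show "poly ?p (c s) = (if s = r then 1 else 0)"
    using assms ne by (auto simp: q_def poly_prod)
qed

text \<open>The nodal polynomial is monic of degree \<open>card A\<close>, so subtracting the right
  multiple cancels the top coefficient.\<close>

lemma degree_monic_reduce:
  fixes p :: "'b::idom poly" and c :: "'a \<Rightarrow> 'b"
  assumes "finite A" "A \<noteq> {}" "degree p \<le> card A"
  shows "degree (p - smult (coeff p (card A)) (\<Prod>r\<in>A. [:- c r, 1:])) < card A"
proof -
  let ?q = "\<Prod>r\<in>A. [:- c r, 1:]"
  have d: "degree ?q = card A" by (subst degree_prod_sum_eq) auto
  have "lead_coeff ?q = 1" by (subst lead_coeff_prod) auto
  then have "coeff (p - smult (coeff p (card A)) ?q) (card A) = 0"
    by (simp add: d)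
  moreover have "degree (p - smult (coeff p (card A)) ?q) \<le> card A"
    using assms(3) d degree_smult_le[of _ ?q] by (intro degree_diff_le) auto
  \<comment> \<open>The difference may be the zero polynomial, whose degree is 0 by convention; the
    strict inequality then rests on \<open>card A > 0\<close>.\<close>
  moreover have "card A > 0" using assms by (simp add: card_gt_0_iff)
  ultimately show ?thesis using eq_zero_or_degree_less by fastforce
qed

text \<open>Both sides are linear in \<open>p\<close>, so exactness on monomials extends to
  polynomials. In the application \<open>\<sigma>\<close> is the local coordinate of a mesh
  interval.\<close>

lemma quadrature_exact_poly:
  fixes v \<sigma> :: "real \<Rightarrow> real" and w c :: "'a \<Rightarrow> real"
  assumes v: "v absolutely_integrable_on {a..b}" and \<sigma>: "continuous_on {a..b} \<sigma>"
    and ex: "\<And>k. k < K \<Longrightarrow> (\<Sum>r\<in>A. w r * c r ^ k) = integral {a..b} (\<lambda>s. v s * \<sigma> s ^ k)"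
    and p: "degree p < K"
  shows "(\<Sum>r\<in>A. w r * poly p (c r)) = integral {a..b} (\<lambda>s. v s * poly p (\<sigma> s))"
proof -
  have int: "(\<lambda>s. v s * \<sigma> s ^ k) integrable_on {a..b}" for k
    by (intro set_lebesgue_integral_eq_integral(1)[OF absolutely_integrable_continuous_mult[OF v]]
          continuous_intros \<sigma>)
  have "(\<Sum>r\<in>A. w r * poly p (c r)) = (\<Sum>i\<le>degree p. coeff p i * (\<Sum>r\<in>A. w r * c r ^ i))"
    unfolding poly_altdef sum_distrib_left
    by (subst sum.swap) (simp add: mult.left_commute)
  also have "\<dots> = (\<Sum>i\<le>degree p. coeff p i * integral {a..b} (\<lambda>s. v s * \<sigma> s ^ i))"
    using ex p by (intro sum.cong) auto
  also have "\<dots> = (\<Sum>i\<le>degree p. integral {a..b} (\<lambda>s. coeff p i * (v s * \<sigma> s ^ i)))"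
    by simp
  also have "\<dots> = integral {a..b} (\<lambda>s. \<Sum>i\<le>degree p. coeff p i * (v s * \<sigma> s ^ i))"
    by (intro integral_sum[symmetric] integrable_on_mult_right int) auto
  also have "(\<lambda>s. \<Sum>i\<le>degree p. coeff p i * (v s * \<sigma> s ^ i)) = (\<lambda>s. v s * poly p (\<sigma> s))"
    unfolding poly_altdef sum_distrib_left by (simp add: mult.left_commute)
  finally show ?thesis .
qed

text \<open>Applying the rule to a Lagrange basis polynomial isolates a single weight, and that
  polynomial is bounded on the unit interval. \<open>N\<close> is fixed before the interval and
  \<open>v\<close>, so it depends on the nodes alone and is uniform in the step-size.\<close>

lemma interpolatory_weights_bound:
  fixes c :: "'a \<Rightarrow> real"
  assumes "finite A" "inj_on c A"
  obtains N where "N \<ge> 0"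
    "\<And>(a::real) b v \<sigma> w. v absolutely_integrable_on {a..b} \<Longrightarrow> continuous_on {a..b} \<sigma> \<Longrightarrow> \<sigma> ` {a..b} \<subseteq> {0..1} \<Longrightarrow>
       (\<And>k. k < card A \<Longrightarrow> (\<Sum>r\<in>A. w r * c r ^ k) = integral {a..b} (\<lambda>s. v s * \<sigma> s ^ k)) \<Longrightarrow>
       (\<Sum>r\<in>A. \<bar>w r\<bar>) \<le> N * integral {a..b} (\<lambda>s. \<bar>v s\<bar>)"
proof -
  have "\<forall>r\<in>A. \<exists>p. degree p < card A \<and> (\<forall>s\<in>A. poly p (c s) = (if s = r then 1 else 0))"
    using lagrange_basis_exists[OF assms] by blast
  then obtain l where l: "\<And>r. r \<in> A \<Longrightarrow> degree (l r) < card A"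
    "\<And>r s. r \<in> A \<Longrightarrow> s \<in> A \<Longrightarrow> poly (l r) (c s) = (if s = r then 1 else 0)"
    by metis
  have "\<exists>M. \<forall>u\<in>{0..1}. \<bar>poly (l r) u\<bar> \<le> M" for r
  proof -
    have "continuous_on {0..1} (poly (l r))" by (intro continuous_intros)
    from compact_imp_bounded[OF compact_continuous_image[OF this compact_Icc]]
    show ?thesis unfolding bounded_iff by auto
  qed
  then obtain M where M: "\<And>r u. u \<in> {0..1} \<Longrightarrow> \<bar>poly (l r) u\<bar> \<le> M r" by metis
  have Mpos: "M r \<ge> 0" for r using M[of 0 r] by auto
  show ?thesis
  proof (rule that[of "sum M A"])
    show "sum M A \<ge> 0" using Mpos by (intro sum_nonneg) auto
    fix a b :: real and v \<sigma> w
    assume v: "v absolutely_integrable_on {a..b}" and s: "continuous_on {a..b} \<sigma>" "\<sigma> ` {a..b} \<subseteq> {0..1}"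
      and ex: "\<And>k. k < card A \<Longrightarrow> (\<Sum>r\<in>A. w r * c r ^ k) = integral {a..b} (\<lambda>s. v s * \<sigma> s ^ k)"
    have "\<bar>w r\<bar> \<le> M r * integral {a..b} (\<lambda>s. \<bar>v s\<bar>)" if r: "r \<in> A" for r
    proof -
      have "(\<Sum>s\<in>A. w s * poly (l r) (c s)) = (\<Sum>s\<in>A. if s = r then w s else 0)"
        using l(2)[OF r] by (intro sum.cong) auto
      then have "w r = (\<Sum>s\<in>A. w s * poly (l r) (c s))" using r assms(1) by simp
      also have "\<dots> = integral {a..b} (\<lambda>s. v s * poly (l r) (\<sigma> s))"
        by (rule quadrature_exact_poly[OF v s(1) ex l(1)[OF r]])
      also have "\<bar>\<dots>\<bar> \<le> M r * integral {a..b} (\<lambda>s. \<bar>v s\<bar>)"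
        by (rule abs_integral_mult_le[OF v continuous_on_poly[OF s(1)] M[OF subsetD[OF s(2) imageI]]])
      finally show ?thesis .
    qed
    then show "(\<Sum>r\<in>A. \<bar>w r\<bar>) \<le> sum M A * integral {a..b} (\<lambda>s. \<bar>v s\<bar>)"
      unfolding sum_distrib_right by (rule sum_mono)
  qed
qed

text \<open>The Taylor polynomial splits into a part of degree below \<open>card A\<close>, on which
  the rule is exact, and a multiple of the nodal polynomial, which the rule maps to 0. The integral
  of that multiple is the leading error. The Taylor remainder is seen once by the integral and once
  by the rule, whence the factor \<open>1 + N\<close>.\<close>

lemma quadrature_local_error:
  fixes c :: "'a \<Rightarrow> real"
  assumes h: "h > 0" and A: "finite A" "A \<noteq> {}" and c: "c ` A \<subseteq> {0..1}"
    and v: "v absolutely_integrable_on {a..a + h}"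
    and ex: "\<And>k. k < card A \<Longrightarrow>
      (\<Sum>r\<in>A. w r * c r ^ k) = integral {a..a + h} (\<lambda>s. v s * ((s - a) / h) ^ k)"
    and w: "(\<Sum>r\<in>A. \<bar>w r\<bar>) \<le> N * integral {a..a + h} (\<lambda>s. \<bar>v s\<bar>)"
    and g: "continuous_on {a..a + h} g"
    and taylor: "\<And>s. s \<in> {a..a + h} \<Longrightarrow> \<bar>g s - (\<Sum>k\<le>card A. d k * (s - a) ^ k)\<bar> \<le> C"
  shows "\<bar>integral {a..a + h} (\<lambda>s. v s * g s) - (\<Sum>r\<in>A. w r * g (a + c r * h))
      - d (card A) * h ^ card A * integral {a..a + h} (\<lambda>s. v s * (\<Prod>r\<in>A. (s - a) / h - c r))\<bar>
    \<le> C * (1 + N) * integral {a..a + h} (\<lambda>s. \<bar>v s\<bar>)"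
proof -
  define K where "K = card A"
  let ?I = "{a..a + h}" and ?\<sigma> = "\<lambda>s. (s - a) / h"
  define W where "W = integral ?I (\<lambda>s. \<bar>v s\<bar>)"
  define T where "T = (\<lambda>s. \<Sum>k\<le>K. d k * (s - a) ^ k)"
  \<comment> \<open>The Taylor polynomial in the local coordinate \<open>u = (s - a) / h\<close>;
    the change of variable puts the powers of \<open>h\<close> into the coefficients.\<close>
  define p where "p = (\<Sum>k\<le>K. monom (d k * h ^ k) k)"
  define q where "q = p - smult (d K * h ^ K) (\<Prod>r\<in>A. [:- c r, 1:])"
  have p: "poly p u = T (a + u * h)" for u
    by (simp add: p_def T_def poly_sum poly_monom power_mult_distrib mult_ac)
  have cp: "coeff p K = d K * h ^ K"
    by (simp add: p_def coeff_sum)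
  have dp: "degree p \<le> K"
    unfolding p_def by (intro degree_sum_le) (auto intro: order_trans[OF degree_monom_le])
  have dq: "degree q < K"
    using degree_monic_reduce[OF A, of p c] dp cp by (simp add: q_def K_def)
  have pq: "poly q u = T (a + u * h) - d K * h ^ K * (\<Prod>r\<in>A. u - c r)" for u
    by (simp add: q_def p poly_prod)
  have cs: "continuous_on ?I ?\<sigma>" using h by (intro continuous_intros) auto
  have int: "(\<lambda>s. v s * u s) integrable_on ?I" if "continuous_on ?I u" for u
    by (rule set_lebesgue_integral_eq_integral(1)[OF absolutely_integrable_continuous_mult[OF v that]])
  have cT: "continuous_on ?I T" unfolding T_def by (intro continuous_intros)
  have cq: "continuous_on ?I (\<lambda>s. \<Prod>r\<in>A. ?\<sigma> s - c r)" by (intro continuous_intros cs)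
  have "(\<Sum>r\<in>A. w r * poly q (c r)) = integral ?I (\<lambda>s. v s * poly q (?\<sigma> s))"
    using dq by (intro quadrature_exact_poly[OF v cs, of K]) (auto simp: ex K_def)
  also have "\<dots> = integral ?I (\<lambda>s. v s * T s - d K * h ^ K * (v s * (\<Prod>r\<in>A. ?\<sigma> s - c r)))"
  proof (intro integral_cong)
    fix s
    have "a + ?\<sigma> s * h = s" using h by simp
    then show "v s * poly q (?\<sigma> s) = v s * T s - d K * h ^ K * (v s * (\<Prod>r\<in>A. ?\<sigma> s - c r))"
      unfolding pq by (simp only: right_diff_distrib mult_ac)
  qed
  also have "\<dots> = integral ?I (\<lambda>s. v s * T s)
      - d K * h ^ K * integral ?I (\<lambda>s. v s * (\<Prod>r\<in>A. ?\<sigma> s - c r))"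
    by (subst integral_diff) (auto intro!: int cT cq integrable_on_mult_right)
  finally have 1: "(\<Sum>r\<in>A. w r * poly q (c r)) = integral ?I (\<lambda>s. v s * T s)
      - d K * h ^ K * integral ?I (\<lambda>s. v s * (\<Prod>r\<in>A. ?\<sigma> s - c r))" .
  \<comment> \<open>The nodal polynomial vanishes at the nodes, so the rule cannot distinguish
    \<open>q\<close> from the Taylor polynomial.\<close>
  have 2: "poly q (c r) = T (a + c r * h)" if "r \<in> A" for r
    using that A by (auto simp: pq prod_zero_iff)
  have 3: "integral ?I (\<lambda>s. v s * (g s - T s)) = integral ?I (\<lambda>s. v s * g s) - integral ?I (\<lambda>s. v s * T s)"
    unfolding right_diff_distrib by (intro integral_diff int g cT)
  have 4: "(\<Sum>r\<in>A. w r * (g (a + c r * h) - T (a + c r * h)))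
      = (\<Sum>r\<in>A. w r * g (a + c r * h)) - (\<Sum>r\<in>A. w r * poly q (c r))"
    by (simp add: 2 algebra_simps sum_subtractf)
  have t: "\<bar>g s - T s\<bar> \<le> C" if "s \<in> ?I" for s
    using taylor[OF that] by (simp add: T_def K_def)
  have C: "C \<ge> 0" using t[of a] h by auto
  have "\<bar>integral ?I (\<lambda>s. v s * (g s - T s))\<bar> \<le> C * W"
    unfolding W_def by (intro abs_integral_mult_le[OF v] continuous_intros g cT t) auto
  moreover have "\<bar>\<Sum>r\<in>A. w r * (g (a + c r * h) - T (a + c r * h))\<bar> \<le> C * (N * W)"
  proof -
    have "\<bar>\<Sum>r\<in>A. w r * (g (a + c r * h) - T (a + c r * h))\<bar> \<le> (\<Sum>r\<in>A. \<bar>w r\<bar> * C)"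
    proof (rule sum_norm_le[THEN order_trans[OF eq_refl[OF real_norm_def[symmetric]]]])
      fix r assume r: "r \<in> A"
      then have "c r * h \<in> {0..h}" using c h by (auto simp: image_subset_iff mult_left_le_one_le)
      then show "norm (w r * (g (a + c r * h) - T (a + c r * h))) \<le> \<bar>w r\<bar> * C"
        unfolding real_norm_def abs_mult by (intro mult_left_mono t) auto
    qed
    also have "\<dots> \<le> C * (N * W)"
      unfolding W_def sum_distrib_right[symmetric] using mult_right_mono[OF w C] by (simp only: mult_ac)
    finally show ?thesis .
  qed
  ultimately show ?thesis
    using 1 3 4 unfolding K_def[symmetric] W_def[symmetric] by (simp add: algebra_simps)
qed

section \<open>Summation of the local errors over the mesh\<close>

lemma integral_sum_mesh:
  fixes u :: "real \<Rightarrow> real"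
  assumes "h \<ge> 0" "u integrable_on {a..a + real n * h}"
  shows "(\<Sum>j<n. integral {a + real j * h..a + real j * h + h} u) = integral {a..a + real n * h} u"
  using assms(2)
proof (induction n)
  case (Suc n)
  have le: "a \<le> a + real n * h" "a + real n * h \<le> a + real (Suc n) * h"
    using assms(1) by (auto simp: algebra_simps)
  have "u integrable_on {a..a + real n * h}"
    by (rule integrable_on_subinterval[OF Suc.prems]) (use le in auto)
  from Suc.IH[OF this] Henstock_Kurzweil_Integration.integral_combine[OF le Suc.prems] show ?case
    by (simp add: algebra_simps)
qed auto

lemma mesh_subset:
  fixes a h :: real
  assumes "h \<ge> 0" "j < n"
  shows "{a + real j * h..a + real j * h + h} \<subseteq> {a..a + real n * h}"
proof -
  have "real (Suc j) * h \<le> real n * h" using assms by (intro mult_right_mono) auto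
  then show ?thesis using assms by (auto simp: algebra_simps intro: order_trans[OF mult_nonneg_nonneg])
qed

text \<open>The leading local errors are left as explicit moments of the nodal polynomial, because
  the two orders of convergence differ only in how the sum of these moments is estimated.
  \<open>C1\<close> and \<open>C2\<close> are fixed before \<open>n\<close>, \<open>h\<close> and
  the weights.\<close>

lemma composite_quadrature_error:
  fixes c :: "'a \<Rightarrow> real"
  assumes A: "finite A" "A \<noteq> {}" "inj_on c A" "c ` A \<subseteq> {0..1}"
    and t: "t0 < t" "t \<le> T" and f: "Ck_on (card A + 1) f {t0..T}"
    and v: "v absolutely_integrable_on {t0..t}"
  obtains C1 C2 where "C1 \<ge> 0" "C2 \<ge> 0"
    "\<And>n h w. n > 0 \<Longrightarrow> h = (t - t0) / real n \<Longrightarrow>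
      (\<And>j k. j < n \<Longrightarrow> k < card A \<Longrightarrow> (\<Sum>r\<in>A. w j r * c r ^ k) =
         integral {t0 + real j * h..t0 + real j * h + h} (\<lambda>s. v s * ((s - (t0 + real j * h)) / h) ^ k)) \<Longrightarrow>
      \<bar>integral {t0..t} (\<lambda>s. v s * f s) - (\<Sum>j<n. \<Sum>r\<in>A. w j r * f (t0 + real j * h + c r * h))\<bar>
      \<le> C1 * h ^ card A * (\<Sum>j<n. \<bar>integral {t0 + real j * h..t0 + real j * h + h}
              (\<lambda>s. v s * (\<Prod>r\<in>A. (s - (t0 + real j * h)) / h - c r))\<bar>) + C2 * h ^ (card A + 1)"
proof -
  define K where "K = card A"
  obtain D where D: "D 0 = f"
    "\<And>k x. k < K + 1 \<Longrightarrow> x \<in> {t0..T} \<Longrightarrow> (D k has_real_derivative D (Suc k) x) (at x within {t0..T})"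
    "continuous_on {t0..T} (D (K + 1))"
    using f unfolding Ck_on_def K_def by blast
  have cD: "continuous_on {t0..T} (D k)" if "k \<le> K" for k
    by (rule DERIV_continuous_on[of _ _ "D (Suc k)"]) (use D(2) that in auto)
  have cf: "continuous_on {t0..T} f" using cD[of 0] D(1) by simp
  obtain M where M: "M > 0" "\<And>x. x \<in> {t0..T} \<Longrightarrow> norm (D K x) \<le> M"
    using compact_imp_bounded[OF compact_continuous_image[OF cD[of K] compact_Icc]]
    unfolding bounded_pos by auto
  obtain M' where M': "M' > 0" "\<And>x. x \<in> {t0..T} \<Longrightarrow> norm (D (K + 1) x) \<le> M'"
    using compact_imp_bounded[OF compact_continuous_image[OF D(3) compact_Icc]]
    unfolding bounded_pos by auto
  obtain N where N: "N \<ge> 0"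
    "\<And>(a::real) b v \<sigma> w. v absolutely_integrable_on {a..b} \<Longrightarrow> continuous_on {a..b} \<sigma> \<Longrightarrow> \<sigma> ` {a..b} \<subseteq> {0..1} \<Longrightarrow>
       (\<And>k. k < card A \<Longrightarrow> (\<Sum>r\<in>A. w r * c r ^ k) = integral {a..b} (\<lambda>s. v s * \<sigma> s ^ k)) \<Longrightarrow>
       (\<Sum>r\<in>A. \<bar>w r\<bar>) \<le> N * integral {a..b} (\<lambda>s. \<bar>v s\<bar>)"
    using interpolatory_weights_bound[OF A(1,3)] by blast
  define W where "W = integral {t0..t} (\<lambda>s. \<bar>v s\<bar>)"
  have vi: "(\<lambda>s. \<bar>v s\<bar>) integrable_on {t0..t}"
    using v by (simp add: absolutely_integrable_on_def)
  have W: "W \<ge> 0" unfolding W_def using vi by (intro integral_nonneg) auto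
  \<comment> \<open>\<open>C1\<close> bounds the Taylor coefficient of order \<open>K\<close>.
    \<open>C2\<close> combines the remainder constant, the factor \<open>1 + N\<close> from the
    local error and the total mass \<open>W\<close> of \<open>v\<close>.\<close>
  define C1 where "C1 = M / fact K"
  define C2 where "C2 = M' / fact K * (1 + N) * W"
  show ?thesis
  proof (rule that[of C1 C2])
    show "C1 \<ge> 0" "C2 \<ge> 0" using M M' N W by (auto simp: C1_def C2_def)
    fix n :: nat and h w
    assume n: "n > 0" and h: "h = (t - t0) / real n"
      and ex: "\<And>j k. j < n \<Longrightarrow> k < card A \<Longrightarrow> (\<Sum>r\<in>A. w j r * c r ^ k) =
         integral {t0 + real j * h..t0 + real j * h + h} (\<lambda>s. v s * ((s - (t0 + real j * h)) / h) ^ k)"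
    have h0: "h > 0" and tn: "t = t0 + real n * h" using n t h by auto
    define a where "a = (\<lambda>j. t0 + real j * h)"
    let ?I = "\<lambda>j. {a j..a j + h}"
    define Q where "Q = (\<lambda>j. integral (?I j) (\<lambda>s. v s * (\<Prod>r\<in>A. (s - a j) / h - c r)))"
    define V where "V = (\<lambda>j. integral (?I j) (\<lambda>s. \<bar>v s\<bar>))"
    define d where "d = (\<lambda>j k. D k (a j) / fact k)"
    define E where "E = (\<lambda>j. integral (?I j) (\<lambda>s. v s * f s) - (\<Sum>r\<in>A. w j r * f (a j + c r * h)))"
    have sub: "?I j \<subseteq> {t0..t}" if "j < n" for j
      using mesh_subset[of h j n t0] h0 that by (simp add: tn a_def)
    have loc: "\<bar>E j - d j K * h ^ K * Q j\<bar> \<le> M' * h ^ (K + 1) / fact K * (1 + N) * V j" if j: "j < n" for j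
    proof -
      have vj: "v absolutely_integrable_on ?I j"
        using absolutely_integrable_on_subinterval[OF v sub[OF j]] .
      have img: "(\<lambda>s. (s - a j) / h) ` ?I j \<subseteq> {0..1}" using h0 by (auto simp: field_simps)
      have cs: "continuous_on (?I j) (\<lambda>s. (s - a j) / h)" using h0 by (intro continuous_intros) auto
      have exj: "(\<Sum>r\<in>A. w j r * c r ^ k) = integral (?I j) (\<lambda>s. v s * ((s - a j) / h) ^ k)"
        if "k < card A" for k
        using ex[OF j that] by (simp add: a_def)
      have tay: "\<bar>f s - (\<Sum>k\<le>card A. d j k * (s - a j) ^ k)\<bar> \<le> M' * h ^ (K + 1) / fact K"
        if s: "s \<in> ?I j" for s
      proof -
        have in1: "s \<in> {t0..T}" "a j \<in> {t0..T}" using sub[OF j] s t h0 by auto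
        \<comment> \<open>The remainder appears with \<open>fact K\<close> instead of
          \<open>fact (K + 1)\<close>, which affects only the constant.\<close>
        have "norm (D 0 s - (\<Sum>i\<le>K. D i (a j) * (s - a j) ^ i / fact i)) \<le> M' * norm (s - a j) ^ Suc K / fact K"
          by (rule field_Taylor[where S = "{t0..T}"]) (use D(2) M' in1 in auto)
        also have "\<dots> \<le> M' * h ^ (K + 1) / fact K"
          using M' s by (auto intro!: divide_right_mono mult_left_mono power_mono simp del: power_Suc)
        finally show ?thesis by (simp add: D(1) d_def K_def)
      qed
      have "continuous_on (?I j) f" using continuous_on_subset[OF cf] sub[OF j] t by auto
      from quadrature_local_error[OF h0 A(1,2,4) vj exj N(2)[OF vj cs img exj] this tay]
      show ?thesis by (simp add: E_def Q_def V_def K_def)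
    qed
    have E_le: "\<bar>E j\<bar> \<le> C1 * h ^ K * \<bar>Q j\<bar> + M' * h ^ (K + 1) / fact K * (1 + N) * V j" if j: "j < n" for j
    proof -
      have "a j \<in> {t0..T}" using sub[OF j] t h0 by auto
      then have "\<bar>d j K\<bar> \<le> C1" using M by (auto simp: d_def C1_def divide_right_mono)
      then have "\<bar>d j K * h ^ K * Q j\<bar> \<le> C1 * h ^ K * \<bar>Q j\<bar>"
        using h0 by (auto simp: abs_mult intro!: mult_right_mono)
      then show ?thesis using loc[OF j] by linarith
    qed
    have int: "(\<lambda>s. v s * f s) integrable_on {t0..t}"
      using t by (intro set_lebesgue_integral_eq_integral(1)[OF absolutely_integrable_continuous_mult[OF v]]
                    continuous_on_subset[OF cf]) auto
    \<comment> \<open>The masses of \<open>v\<close> on the mesh intervals add up to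
      \<open>W\<close> whatever \<open>n\<close> is, so no power of \<open>h\<close> is lost in
      summing the remainders.\<close>
    have sV: "(\<Sum>j<n. V j) = W"
      unfolding V_def W_def a_def tn using vi h0 by (intro integral_sum_mesh) (auto simp: tn)
    have "integral {t0..t} (\<lambda>s. v s * f s) = (\<Sum>j<n. integral (?I j) (\<lambda>s. v s * f s))"
      unfolding a_def tn using int h0 by (intro integral_sum_mesh[symmetric]) (auto simp: tn)
    then have "\<bar>integral {t0..t} (\<lambda>s. v s * f s) - (\<Sum>j<n. \<Sum>r\<in>A. w j r * f (a j + c r * h))\<bar> = \<bar>\<Sum>j<n. E j\<bar>"
      by (simp add: E_def sum_subtractf)
    also have "\<dots> \<le> (\<Sum>j<n. C1 * h ^ K * \<bar>Q j\<bar> + M' * h ^ (K + 1) / fact K * (1 + N) * V j)"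
      using E_le by (intro order_trans[OF sum_abs] sum_mono) auto
    also have "\<dots> = C1 * h ^ K * (\<Sum>j<n. \<bar>Q j\<bar>) + C2 * h ^ (K + 1)"
      unfolding sum.distrib sum_distrib_left[symmetric] sV C2_def by simp
    finally show "\<bar>integral {t0..t} (\<lambda>s. v s * f s) - (\<Sum>j<n. \<Sum>r\<in>A. w j r * f (t0 + real j * h + c r * h))\<bar>
      \<le> C1 * h ^ card A * (\<Sum>j<n. \<bar>integral {t0 + real j * h..t0 + real j * h + h}
              (\<lambda>s. v s * (\<Prod>r\<in>A. (s - (t0 + real j * h)) / h - c r))\<bar>) + C2 * h ^ (card A + 1)"
      by (simp add: a_def Q_def K_def)
  qed
qed

section \<open>Moments of weakly singular kernels\<close>

text \<open>The reflection that sends \<open>s\<close> to \<open>t - s\<close> moves the possible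
  singularity to 0, where the integral of a power is known.\<close>

lemma has_integral_powr_kernel:
  fixes \<alpha> a t :: real
  assumes "\<alpha> > 0" "a \<le> t"
  shows "((\<lambda>s. (t - s) powr (\<alpha> - 1)) has_integral (t - a) powr \<alpha> / \<alpha>) {a..t}"
proof -
  have "((\<lambda>x. x powr (\<alpha> - 1)) has_integral (t - a) powr \<alpha> / \<alpha>) (cbox 0 (t - a))"
    using has_integral_powr_from_0[of "\<alpha> - 1" "t - a"] assms by simp
  from has_integral_affinity[OF this, of "-1" t] assms
  show ?thesis by (simp add: image_affinity_cbox[where m = "-1", simplified])
qed

lemma powr_kernel_absolutely_integrable:
  fixes \<alpha> a t :: real
  assumes "\<alpha> > 0" "a \<le> t" "continuous_on {0..(t - a) powr \<alpha>} F"
  shows "(\<lambda>s. (t - s) powr (\<alpha> - 1) * F ((t - s) powr \<alpha>)) absolutely_integrable_on {a..t}"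
proof (rule absolutely_integrable_continuous_mult)
  show "(\<lambda>s. (t - s) powr (\<alpha> - 1)) absolutely_integrable_on {a..t}"
    using has_integral_powr_kernel[OF assms(1,2)]
    by (intro nonnegative_absolutely_integrable_1) auto
  show "continuous_on {a..t} (\<lambda>s. F ((t - s) powr \<alpha>))"
    using assms
    by (intro continuous_on_compose2[OF assms(3)] continuous_on_powr' continuous_intros)
       (auto intro!: powr_mono2)
qed

text \<open>The variation of a monotone sequence telescopes. This keeps the summed oscillations of
  the kernel from growing with the number of mesh intervals.\<close>

lemma sum_abs_diff_monotone:
  fixes y :: "nat \<Rightarrow> real"
  assumes "(\<forall>j<m. y (Suc j) \<le> y j) \<or> (\<forall>j<m. y j \<le> y (Suc j))"
  shows "(\<Sum>j<m. \<bar>y (Suc j) - y j\<bar>) = \<bar>y m - y 0\<bar>"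
  using assms
proof
  assume *: "\<forall>j<m. y (Suc j) \<le> y j"
  then have "(\<Sum>j<m. \<bar>y (Suc j) - y j\<bar>) = (\<Sum>j<m. y j - y (Suc j))"
    by (intro sum.cong) auto
  also have "\<dots> = y 0 - y m" by (rule sum_lessThan_telescope')
  finally have eq: "(\<Sum>j<m. \<bar>y (Suc j) - y j\<bar>) = y 0 - y m" .
  have "0 \<le> (\<Sum>j<m. \<bar>y (Suc j) - y j\<bar>)" by (intro sum_nonneg) auto
  with eq show ?thesis by linarith
next
  assume *: "\<forall>j<m. y j \<le> y (Suc j)"
  then have "(\<Sum>j<m. \<bar>y (Suc j) - y j\<bar>) = (\<Sum>j<m. y (Suc j) - y j)"
    by (intro sum.cong) auto
  also have "\<dots> = y m - y 0" by (rule sum_lessThan_telescope)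
  finally have eq: "(\<Sum>j<m. \<bar>y (Suc j) - y j\<bar>) = y m - y 0" .
  have "0 \<le> (\<Sum>j<m. \<bar>y (Suc j) - y j\<bar>)" by (intro sum_nonneg) auto
  with eq show ?thesis by linarith
qed

text \<open>The difference of products is split so that each summand contains the difference of a
  single power. Both powers are monotone, so these differences are largest between the end points
  \<open>z1\<close> and \<open>z2\<close>, which is the form that telescopes over a mesh.\<close>

lemma powr_kernel_diff_le:
  fixes \<alpha> z z1 z2 :: real
  assumes \<alpha>: "\<alpha> > 0" and z: "0 < z1" "z1 \<le> z" "z \<le> z2"
    and B: "\<bar>F (z powr \<alpha>)\<bar> \<le> B"
    and L: "\<bar>F (z powr \<alpha>) - F (z2 powr \<alpha>)\<bar> \<le> \<Lambda> * \<bar>z powr \<alpha> - z2 powr \<alpha>\<bar>" "\<Lambda> \<ge> 0"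
    and S: "z2 powr (\<alpha> - 1) \<le> S"
  shows "\<bar>z powr (\<alpha> - 1) * F (z powr \<alpha>) - z2 powr (\<alpha> - 1) * F (z2 powr \<alpha>)\<bar>
    \<le> B * \<bar>z1 powr (\<alpha> - 1) - z2 powr (\<alpha> - 1)\<bar> + S * \<Lambda> * \<bar>z1 powr \<alpha> - z2 powr \<alpha>\<bar>"
proof -
  have m1: "\<bar>z powr \<alpha> - z2 powr \<alpha>\<bar> \<le> \<bar>z1 powr \<alpha> - z2 powr \<alpha>\<bar>"
  proof -
    have "z1 powr \<alpha> \<le> z powr \<alpha>" "z powr \<alpha> \<le> z2 powr \<alpha>" using z \<alpha> by (auto intro: powr_mono2)
    then show ?thesis by linarith
  qed
  have m2: "\<bar>z powr (\<alpha> - 1) - z2 powr (\<alpha> - 1)\<bar> \<le> \<bar>z1 powr (\<alpha> - 1) - z2 powr (\<alpha> - 1)\<bar>"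
  \<comment> \<open>The exponent \<open>\<alpha> - 1\<close> changes sign at
    \<open>\<alpha> = 1\<close>, which reverses the monotonicity.\<close>
  proof (cases "\<alpha> \<ge> 1")
    case True
    have "z1 powr (\<alpha> - 1) \<le> z powr (\<alpha> - 1)" "z powr (\<alpha> - 1) \<le> z2 powr (\<alpha> - 1)"
      using z True by (auto intro: powr_mono2)
    then show ?thesis by linarith
  next
    case False
    have "z1 powr (\<alpha> - 1) \<ge> z powr (\<alpha> - 1)" "z powr (\<alpha> - 1) \<ge> z2 powr (\<alpha> - 1)"
      using z False by (auto intro!: powr_mono2')
    then show ?thesis by linarith
  qed
  have "z powr (\<alpha> - 1) * F (z powr \<alpha>) - z2 powr (\<alpha> - 1) * F (z2 powr \<alpha>)
      = F (z powr \<alpha>) * (z powr (\<alpha> - 1) - z2 powr (\<alpha> - 1))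
        + z2 powr (\<alpha> - 1) * (F (z powr \<alpha>) - F (z2 powr \<alpha>))"
    by (simp add: algebra_simps)
  also have "\<bar>\<dots>\<bar> \<le> \<bar>F (z powr \<alpha>)\<bar> * \<bar>z powr (\<alpha> - 1) - z2 powr (\<alpha> - 1)\<bar>
        + z2 powr (\<alpha> - 1) * \<bar>F (z powr \<alpha>) - F (z2 powr \<alpha>)\<bar>"
    by (rule order_trans[OF abs_triangle_ineq]) (simp add: abs_mult)
  also have "\<dots> \<le> B * \<bar>z1 powr (\<alpha> - 1) - z2 powr (\<alpha> - 1)\<bar> + S * (\<Lambda> * \<bar>z1 powr \<alpha> - z2 powr \<alpha>\<bar>)"
    using B m2 S L(1) order_trans[OF L(1) mult_left_mono[OF m1 L(2)]]
    by (intro add_mono mult_mono) (auto intro: order_trans[OF powr_ge_zero])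
  finally show ?thesis by (simp add: mult.assoc)
qed

text \<open>The power is largest at \<open>L\<close> when \<open>\<alpha> \<ge> 1\<close> and at
  \<open>h\<close> otherwise; the maximum with 1 lets one constant serve both cases.\<close>

lemma powr_le_on_mesh:
  fixes \<alpha> h x L :: real
  assumes "0 < h" "h \<le> x" "x \<le> L"
  shows "x powr (\<alpha> - 1) \<le> max 1 (L powr (\<alpha> - 1)) * h powr (min \<alpha> 1 - 1)"
proof (cases "\<alpha> \<ge> 1")
  case True
  then have "x powr (\<alpha> - 1) \<le> L powr (\<alpha> - 1)" using assms by (intro powr_mono2) auto
  then show ?thesis using True assms by (auto simp: min_def max_def)
next
  case False
  then have "x powr (\<alpha> - 1) \<le> h powr (\<alpha> - 1)" using assms by (intro powr_mono2') auto
  also have "\<dots> \<le> max 1 (L powr (\<alpha> - 1)) * h powr (\<alpha> - 1)"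
    using mult_right_mono[of 1 "max 1 (L powr (\<alpha> - 1))" "h powr (\<alpha> - 1)"] by simp
  finally show ?thesis using False by (simp add: min_def)
qed

text \<open>Away from \<open>t\<close>, an interval contributes at most its length \<open>h\<close>
  times the oscillation of the kernel. The oscillations sum to a multiple of \<open>S\<close>, of
  size \<open>h powr (min \<alpha> 1 - 1)\<close>, so that \<open>h * S\<close> has the claimed
  order; the interval touching \<open>t\<close> is estimated separately.\<close>

lemma zero_mean_moments_bound:
  fixes \<alpha> t0 t :: real
  assumes \<alpha>: "\<alpha> > 0" and t: "t0 < t"
    and B: "\<And>x. x \<in> {0..(t - t0) powr \<alpha>} \<Longrightarrow> \<bar>F x\<bar> \<le> B"
    and \<Lambda>: "\<Lambda> \<ge> 0" "\<And>x y. x \<in> {0..(t - t0) powr \<alpha>} \<Longrightarrow> y \<in> {0..(t - t0) powr \<alpha>} \<Longrightarrow>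
              \<bar>F x - F y\<bar> \<le> \<Lambda> * \<bar>x - y\<bar>"
    and F: "continuous_on {0..(t - t0) powr \<alpha>} F"
    and q: "continuous_on UNIV q" "\<And>u. u \<in> {0..1} \<Longrightarrow> \<bar>q u\<bar> \<le> M" "integral {0..1} q = 0"
  obtains C where "\<And>n h. n > 0 \<Longrightarrow> h = (t - t0) / real n \<Longrightarrow>
    (\<Sum>j<n. \<bar>integral {t0 + real j * h..t0 + real j * h + h}
       (\<lambda>s. (t - s) powr (\<alpha> - 1) * F ((t - s) powr \<alpha>) * q ((s - (t0 + real j * h)) / h))\<bar>)
    \<le> C * h powr min \<alpha> 1"
proof -
  define L where "L = t - t0"
  define v where "v = (\<lambda>s. (t - s) powr (\<alpha> - 1) * F ((t - s) powr \<alpha>))"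
  have v: "v absolutely_integrable_on {t0..t}"
    unfolding v_def using \<alpha> t F by (intro powr_kernel_absolutely_integrable) auto
  have B0: "B \<ge> 0" using B[of 0] by auto
  have M0: "M \<ge> 0" using q(2)[of 0] by auto
  define Sc where "Sc = max 1 (L powr (\<alpha> - 1))"
  \<comment> \<open>The three summands come from the variation of the power with exponent
    \<open>\<alpha> - 1\<close>, the variation of the power with exponent \<open>\<alpha>\<close>,
    and the last interval.\<close>
  define C where "C = M * (B + \<Lambda> * L powr \<alpha> + B / \<alpha>) * Sc"
  show ?thesis
  proof (rule that[of C])
    fix n :: nat and h assume n: "n > 0" and h: "h = (t - t0) / real n"
    have h0: "h > 0" and tn: "t = t0 + real n * h" using n t h by auto
    define a where "a = (\<lambda>j. t0 + real j * h)"
    let ?I = "\<lambda>j. {a j..a j + h}"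
    \<comment> \<open>\<open>x j\<close> is the distance from the mesh point \<open>a j\<close> to
      \<open>t\<close>; it is 0 for \<open>j = n\<close> and at least \<open>h\<close> before
      that.\<close>
    define x where "x = (\<lambda>j. real (n - j) * h)"
    define S where "S = Sc * h powr (min \<alpha> 1 - 1)"
    define D where "D = (\<lambda>j. B * \<bar>x (Suc j) powr (\<alpha> - 1) - x j powr (\<alpha> - 1)\<bar>
                       + S * \<Lambda> * \<bar>x (Suc j) powr \<alpha> - x j powr \<alpha>\<bar>)"
    define Q where "Q = (\<lambda>j. integral (?I j) (\<lambda>s. v s * q ((s - a j) / h)))"
    obtain m where m: "n = Suc m" using n by (cases n) auto
    have xa: "t - a j = x j" if "j \<le> n" for j
      using that by (simp add: x_def a_def tn of_nat_diff algebra_simps)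
    have xS: "x (Suc j) = x j - h" if "j < n" for j
      using that by (simp add: x_def of_nat_diff algebra_simps)
    have xh: "h \<le> x j" if "j < n" for j
      using that h0 mult_right_mono[of 1 "real (n - j)" h] by (simp add: x_def)
    have xL: "x j \<le> L" for j
      using h0 by (auto simp: x_def L_def tn intro!: mult_right_mono)
    have a0: "t0 \<le> a j" for j using h0 by (simp add: a_def)
    have S: "y powr (\<alpha> - 1) \<le> S" if "h \<le> y" "y \<le> L" for y
      using powr_le_on_mesh[OF h0 that] by (simp add: S_def Sc_def)
    have cq: "continuous_on (?I j) (\<lambda>s. q ((s - a j) / h))" for j
      using h0 by (intro continuous_on_compose2[OF q(1)] continuous_intros) auto
    have bq: "\<bar>q ((s - a j) / h)\<bar> \<le> M" if "s \<in> ?I j" for s j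
      using that h0 by (intro q(2)) (auto simp: field_simps)
    have zero: "integral (?I j) (\<lambda>s. q ((s - a j) / h)) = 0" for j
    proof -
      have "(q has_integral 0) (cbox 0 1)"
        using q(3) integrable_continuous_real[OF continuous_on_subset[OF q(1)], of 0 1]
        by (simp add: has_integral_iff)
      from has_integral_affinity'[OF this, of "1/h" "- a j / h"] h0
      have "((\<lambda>s. q ((s - a j) / h)) has_integral 0) (?I j)"
        by (simp add: diff_divide_distrib add_divide_distrib algebra_simps)
      then show ?thesis by (rule integral_unique)
    qed
    \<comment> \<open>The restriction \<open>j < m\<close> leaves out the interval that touches
      \<open>t\<close>, so the distance to \<open>t\<close> stays at least \<open>h\<close>.\<close>
    have early: "\<bar>Q j\<bar> \<le> M * h * D j" if j: "j < m" for j
    proof -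
      have jn: "j < n" "Suc j < n" using j m by auto
      have sub: "?I j \<subseteq> {t0..t}"
        using xa[of j] xh[of j] jn a0[of j] by auto
      have vj: "v absolutely_integrable_on ?I j"
        using absolutely_integrable_on_subinterval[OF v sub] .
      have vj': "(\<lambda>s. v s - v (a j)) absolutely_integrable_on ?I j"
        by (intro set_integral_diff vj) auto
      \<comment> \<open>The subtracted integral is zero because \<open>q\<close> has mean
        zero.\<close>
      have "Q j = integral (?I j) (\<lambda>s. v s * q ((s - a j) / h)) - integral (?I j) (\<lambda>s. v (a j) * q ((s - a j) / h))"
        by (simp add: zero Q_def)
      also have "\<dots> = integral (?I j) (\<lambda>s. (v s - v (a j)) * q ((s - a j) / h))"
        unfolding left_diff_distrib
        by (intro integral_diff[symmetric] integrable_on_mult_right integrable_continuous_real cq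
            set_lebesgue_integral_eq_integral(1)[OF absolutely_integrable_continuous_mult[OF vj]])
      also have "\<bar>\<dots>\<bar> \<le> M * integral (?I j) (\<lambda>s. \<bar>v s - v (a j)\<bar>)"
        by (rule abs_integral_mult_le[OF vj' cq bq])
      also have "integral (?I j) (\<lambda>s. \<bar>v s - v (a j)\<bar>) \<le> integral (?I j) (\<lambda>s. D j)"
      proof (rule integral_le)
        show "(\<lambda>s. \<bar>v s - v (a j)\<bar>) integrable_on ?I j"
          using vj' by (simp add: absolutely_integrable_on_def)
        fix s assume s: "s \<in> ?I j"
        \<comment> \<open>The distances to \<open>t\<close> of the right end, of \<open>s\<close>
          and of the left end take the roles of \<open>z1\<close>, \<open>z\<close> and
          \<open>z2\<close>.\<close>
        have z: "0 < x (Suc j)" "x (Suc j) \<le> t - s" "t - s \<le> x j"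
          using xh[OF jn(2)] h0 s xS[OF jn(1)] xa[of j] jn by auto
        have in1: "(t - s) powr \<alpha> \<in> {0..(t - t0) powr \<alpha>}" "x j powr \<alpha> \<in> {0..(t - t0) powr \<alpha>}"
          using z xL[of j] \<alpha> by (auto simp: L_def intro!: powr_mono2)
        show "\<bar>v s - v (a j)\<bar> \<le> D j"
          using powr_kernel_diff_le[OF \<alpha> z B[OF in1(1)] \<Lambda>(2)[OF in1] \<Lambda>(1) S[OF xh[OF jn(1)] xL]] xa[of j] jn
          by (simp add: v_def D_def)
      qed auto
      also have "integral (?I j) (\<lambda>s. D j) = h * D j" using h0 by simp
      finally show ?thesis using M0 by (simp add: mult_left_mono mult.assoc)
    qed
    have xmono: "x (Suc j) \<le> x j" "x (Suc j) > 0" if "j < m" for j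
      using xS[of j] xh[of "Suc j"] that m h0 by auto
    have sumD: "(\<Sum>j<m. D j) \<le> B * S + S * \<Lambda> * L powr \<alpha>"
    proof -
      have "(\<forall>j<m. x (Suc j) powr (\<alpha> - 1) \<le> x j powr (\<alpha> - 1)) \<or> (\<forall>j<m. x j powr (\<alpha> - 1) \<le> x (Suc j) powr (\<alpha> - 1))"
      proof (cases "\<alpha> \<ge> 1")
        case True
        then show ?thesis using xmono by (intro disjI1) (auto intro!: powr_mono2 simp: less_imp_le)
      next
        case False
        then show ?thesis using xmono by (intro disjI2) (auto intro!: powr_mono2')
      qed
      then have 1: "(\<Sum>j<m. \<bar>x (Suc j) powr (\<alpha> - 1) - x j powr (\<alpha> - 1)\<bar>) = \<bar>x m powr (\<alpha> - 1) - x 0 powr (\<alpha> - 1)\<bar>"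
        by (rule sum_abs_diff_monotone)
      have "\<forall>j<m. x (Suc j) powr \<alpha> \<le> x j powr \<alpha>"
        using xmono \<alpha> by (auto intro!: powr_mono2 simp: less_imp_le)
      then have 2: "(\<Sum>j<m. \<bar>x (Suc j) powr \<alpha> - x j powr \<alpha>\<bar>) = \<bar>x m powr \<alpha> - x 0 powr \<alpha>\<bar>"
        using sum_abs_diff_monotone[of m "\<lambda>j. x j powr \<alpha>"] by blast
      have mn: "m < n" "0 < n" using m by auto
      have "\<bar>x m powr (\<alpha> - 1) - x 0 powr (\<alpha> - 1)\<bar> \<le> S"
        using S[OF xh[OF mn(1)] xL] S[OF xh[OF mn(2)] xL]
          powr_ge_zero[of "x m" "\<alpha> - 1"] powr_ge_zero[of "x 0" "\<alpha> - 1"] by linarith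
      moreover have "\<bar>x m powr \<alpha> - x 0 powr \<alpha>\<bar> \<le> L powr \<alpha>"
      proof -
        have "x m powr \<alpha> \<le> L powr \<alpha>" "x 0 powr \<alpha> \<le> L powr \<alpha>"
          using xh[OF mn(1)] xh[OF mn(2)] h0 xL \<alpha> by (auto intro!: powr_mono2)
        then show ?thesis
          using powr_ge_zero[of "x m" \<alpha>] powr_ge_zero[of "x 0" \<alpha>] by linarith
      qed
      moreover have "S \<ge> 0" by (simp add: S_def Sc_def)
      ultimately show ?thesis
        using B0 \<Lambda>(1) unfolding D_def sum.distrib sum_distrib_left[symmetric] 1 2
        by (intro add_mono mult_left_mono) auto
    qed
    \<comment> \<open>Subtracting \<open>v (a m)\<close> would not help here, since \<open>v\<close>
      may be unbounded near \<open>t\<close>. The kernel is integrated directly, giving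
      \<open>h powr \<alpha> / \<alpha>\<close>, which is at most
      \<open>h * S / \<alpha>\<close>.\<close>
    have last: "\<bar>Q m\<bar> \<le> M * (B * (h * S / \<alpha>))"
    proof -
      have am: "a m + h = t" "a m = t - h" by (auto simp: a_def tn m algebra_simps)
      have sub: "?I m \<subseteq> {t0..t}" using a0[of m] am by auto
      have vm: "v absolutely_integrable_on ?I m"
        using absolutely_integrable_on_subinterval[OF v sub] .
      have hL: "h \<le> L" using xh[of m] xL[of m] m by auto
      have "\<bar>Q m\<bar> \<le> M * integral (?I m) (\<lambda>s. \<bar>v s\<bar>)"
        unfolding Q_def by (rule abs_integral_mult_le[OF vm cq bq])
      also have "integral (?I m) (\<lambda>s. \<bar>v s\<bar>) \<le> B * (h powr \<alpha> / \<alpha>)"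
      proof (rule has_integral_le)
        show "((\<lambda>s. \<bar>v s\<bar>) has_integral integral (?I m) (\<lambda>s. \<bar>v s\<bar>)) (?I m)"
          using vm by (intro integrable_integral) (simp add: absolutely_integrable_on_def)
        show "((\<lambda>s. B * (t - s) powr (\<alpha> - 1)) has_integral B * (h powr \<alpha> / \<alpha>)) (?I m)"
          using has_integral_powr_kernel[OF \<alpha>, of "t - h" t] h0 am
          by (intro has_integral_mult_right) auto
        fix s assume s: "s \<in> ?I m"
        then have "(t - s) powr \<alpha> \<in> {0..(t - t0) powr \<alpha>}"
          using am hL \<alpha> by (auto simp: L_def intro!: powr_mono2)
        from mult_left_mono[OF B[OF this] powr_ge_zero[of "t - s" "\<alpha> - 1"]]
        show "\<bar>v s\<bar> \<le> B * (t - s) powr (\<alpha> - 1)" by (simp add: v_def abs_mult mult.commute)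
      qed
      also have "h powr \<alpha> = h * h powr (\<alpha> - 1)" using h0 by (simp add: powr_diff)
      also have "h powr (\<alpha> - 1) \<le> S" using S[of h] hL by simp
      finally show ?thesis using h0 \<alpha> B0 M0 by (simp add: mult_left_mono divide_right_mono)
    qed
    have hS: "h * S = Sc * h powr min \<alpha> 1" using h0 by (simp add: S_def powr_diff)
    have "(\<Sum>j<n. \<bar>Q j\<bar>) \<le> M * h * (\<Sum>j<m. D j) + M * (B * (h * S / \<alpha>))"
      unfolding m sum.lessThan_Suc sum_distrib_left using last early by (intro add_mono sum_mono) auto
    also have "\<dots> \<le> M * h * (B * S + S * \<Lambda> * L powr \<alpha>) + M * (B * (h * S / \<alpha>))"
    proof -
      have "M * h \<ge> 0" using M0 h0 by simp
      from mult_left_mono[OF sumD this] show ?thesis by (rule add_right_mono)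
    qed
    also have "\<dots> = M * (B + \<Lambda> * L powr \<alpha> + B / \<alpha>) * (h * S)" by (simp add: algebra_simps)
    also have "\<dots> = C * h powr min \<alpha> 1" by (simp add: hS C_def)
    finally show "(\<Sum>j<n. \<bar>integral {t0 + real j * h..t0 + real j * h + h}
       (\<lambda>s. (t - s) powr (\<alpha> - 1) * F ((t - s) powr \<alpha>) * q ((s - (t0 + real j * h)) / h))\<bar>)
    \<le> C * h powr min \<alpha> 1" by (simp add: Q_def v_def a_def)
  qed
qed

section \<open>Order of convergence\<close>

lemma ml_kernel_pos:
  assumes "x > 0"
  shows "ml_kernel \<alpha> \<alpha> x z = x powr (\<alpha> - 1) * mittag_leffler \<alpha> \<alpha> (- (x powr \<alpha>) * z)"
  using assms by (simp add: ml_kernel_def)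

text \<open>Under \<open>s = a + h * x\<close> the distance \<open>t - s\<close> becomes
  \<open>h * (i - x)\<close>. The kernel then scales by \<open>h powr (\<alpha> - 1)\<close> with
  parameter \<open>h powr \<alpha> * lam\<close>, and the differential supplies the missing factor
  \<open>h\<close>. The weight conditions thus become moment conditions on the actual mesh
  interval.\<close>

lemma ml_R_eq_integral:
  fixes \<alpha> h lam a t :: real and i k :: nat
  assumes \<alpha>: "\<alpha> > 0" and h: "h > 0" and i: "i > 0" and t: "t = a + real i * h"
  shows "fact k * h powr \<alpha> * ml_R \<alpha> \<alpha> k (real i) 0 1 (h powr \<alpha> * lam) =
    integral {a..a + h} (\<lambda>s. (t - s) powr (\<alpha> - 1) * mittag_leffler \<alpha> \<alpha> (- ((t - s) powr \<alpha>) * lam) * ((s - a) / h) ^ k)"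
    (is "_ = integral _ ?u")
proof -
  have at: "a + h \<le> t" using mult_right_mono[of 1 "real i" h] h i t by simp
  have "(\<lambda>s. (t - s) powr (\<alpha> - 1) * mittag_leffler \<alpha> \<alpha> (- ((t - s) powr \<alpha>) * lam)) absolutely_integrable_on {a..t}"
    using h at \<alpha>
    by (intro powr_kernel_absolutely_integrable[where F = "\<lambda>x. mittag_leffler \<alpha> \<alpha> (- x * lam)"]
          continuous_on_compose2[OF continuous_on_mittag_leffler[OF \<alpha>]] continuous_intros) auto
  then have "(\<lambda>s. (t - s) powr (\<alpha> - 1) * mittag_leffler \<alpha> \<alpha> (- ((t - s) powr \<alpha>) * lam)) absolutely_integrable_on {a..a + h}"
    by (rule absolutely_integrable_on_subinterval) (use at in auto)
  then have "?u absolutely_integrable_on {a..a + h}"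
    by (rule absolutely_integrable_continuous_mult) (use h in \<open>auto intro!: continuous_intros\<close>)
  then have "(?u has_integral integral {a..a + h} ?u) (cbox a (a + h))"
    by (simp add: set_lebesgue_integral_eq_integral(1) integrable_integral)
  from has_integral_affinity'[OF this h, of a] h
  have U: "((\<lambda>x. ?u (h * x + a)) has_integral integral {a..a + h} ?u / h) {0..1}"
    by (simp add: divide_inverse mult.commute)
  \<comment> \<open>At \<open>i = x = 1\<close> the convention in \<open>ml_kernel\<close> for \<open>\<alpha> = 1\<close> differs from \<open>0 powr 0 = 0\<close>.\<close>
  have "integral {0..1} (\<lambda>x. h powr (\<alpha> - 1) * (ml_kernel \<alpha> \<alpha> (real i - x) (h powr \<alpha> * lam) * (x - 0) ^ k))
      = integral {0..1} (\<lambda>x. ?u (h * x + a))"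
  proof (rule integral_spike[of "{1}"])
    fix x :: real assume x: "x \<in> {0..1} - {1}"
    then have ix: "real i - x > 0" using i by auto
    have "t - (h * x + a) = h * (real i - x)" by (simp add: t algebra_simps)
    then have e: "(t - (h * x + a)) powr p = h powr p * (real i - x) powr p" for p
      using h ix by (simp add: powr_mult)
    show "?u (h * x + a) = h powr (\<alpha> - 1) * (ml_kernel \<alpha> \<alpha> (real i - x) (h powr \<alpha> * lam) * (x - 0) ^ k)"
      unfolding e ml_kernel_pos[OF ix] using h by (simp add: mult_ac)
  qed simp
  then have "h powr (\<alpha> - 1) * integral {0..1} (\<lambda>x. ml_kernel \<alpha> \<alpha> (real i - x) (h powr \<alpha> * lam) * (x - 0) ^ k)
      = integral {a..a + h} ?u / h"
    using integral_unique[OF U] by simp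
  moreover have "h powr \<alpha> = h * h powr (\<alpha> - 1)" using h by (simp add: powr_diff)
  moreover have "Gamma (real k + 1) = fact k" using Gamma_fact[of k, where 'a = real] by (simp add: add.commute)
  ultimately show ?thesis using h by (simp add: ml_R_def field_simps)
qed

text \<open>Only large \<open>n\<close> matter; \<open>n = 0\<close>, where division by zero makes
  the step-size 0, is left out.\<close>

lemma converges_with_orderI:
  assumes "\<And>t. t0 < t \<Longrightarrow> t \<le> T \<Longrightarrow>
    \<exists>C. \<forall>n>0. \<bar>Y t - y ((t - t0) / real n) n\<bar> \<le> C * ((t - t0) / real n) powr p"
  shows "converges_with_order t0 T Y y p"
  unfolding converges_with_order_def
proof
  fix t assume "t \<in> {t0<..T}"
  then obtain C where C: "\<And>n. n > 0 \<Longrightarrow> \<bar>Y t - y ((t - t0) / real n) n\<bar> \<le> C * ((t - t0) / real n) powr p"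
    using assms[of t] by auto
  show "(\<lambda>n. Y t - y ((t - t0) / real n) n) \<in> O(\<lambda>n. ((t - t0) / real n) powr p)"
    by (rule bigoI[of _ C], rule eventually_mono[OF eventually_gt_at_top[of 0]]) (use C in auto)
qed

text \<open>The excess power \<open>1 - \<mu>\<close> of \<open>h\<close> is bounded by that of
  \<open>L\<close>, so a remainder of order \<open>K + 1\<close> fits under the order
  \<open>K + \<mu>\<close>.\<close>

lemma powr_absorb_power:
  fixes h L :: real
  assumes "0 < h" "h \<le> L" "\<mu> \<le> 1"
  shows "h ^ (K + 1) \<le> L powr (1 - \<mu>) * h powr (real K + \<mu>)"
proof -
  have "h ^ (K + 1) = h powr (real K + \<mu>) * h powr (1 - \<mu>)"
    using assms powr_realpow[of h "K + 1"] by (simp add: powr_add[symmetric] add.commute)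
  also have "\<dots> \<le> h powr (real K + \<mu>) * L powr (1 - \<mu>)"
    using assms by (intro mult_left_mono powr_mono2) auto
  finally show ?thesis by (simp add: mult.commute)
qed

theorem corollary4p4:
  fixes \<alpha> lam t0 T :: real
    and y0 :: "nat \<Rightarrow> real"
    and f :: "real \<Rightarrow> real"
    and K :: nat
    and c :: "nat \<Rightarrow> real"
    and b :: "real \<Rightarrow> nat \<Rightarrow> nat \<Rightarrow> real"
  assumes "\<alpha> > 0"
    and "t0 < T"
    and "K \<ge> 1"
    and "Ck_on (K + 1) f {t0..T}"
    and "\<forall>r\<in>{1..K}. c r \<in> {0..1}"
    and "inj_on c {1..K}"
    and "\<forall>h>0. \<forall>n j. j < n \<longrightarrow> (\<forall>k<K.
           (\<Sum>r = 1..K. b h r (n - j) * c r ^ k) =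
             fact k * h powr \<alpha> * ml_R \<alpha> \<alpha> k (real (n - j)) 0 1 (h powr \<alpha> * lam))"
  shows "converges_with_order t0 T (fde_solution \<alpha> lam t0 y0 f)
           (quadrature_method \<alpha> lam t0 y0 f K c b) (real K) \<and>
         (integral {0..1} (\<lambda>u. \<Prod>r = 1..K. (u - c r)) = 0 \<longrightarrow>
           converges_with_order t0 T (fde_solution \<alpha> lam t0 y0 f)
             (quadrature_method \<alpha> lam t0 y0 f K c b) (real K + min \<alpha> 1))"
proof -
  note \<alpha> = assms(1)
  define Y where "Y = fde_solution \<alpha> lam t0 y0 f"
  define y where "y = quadrature_method \<alpha> lam t0 y0 f K c b"
  define F where "F = (\<lambda>x. mittag_leffler \<alpha> \<alpha> (- x * lam))"
  \<comment> \<open>\<open>v t\<close> agrees with the Mittag-Leffler kernel except at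
    \<open>s = t\<close> for \<open>\<alpha> = 1\<close>, where \<open>0 powr 0 = 0\<close> replaces
    the value 1.\<close>
  define v where "v = (\<lambda>t s. (t - s) powr (\<alpha> - 1) * F ((t - s) powr \<alpha>))"
  define q where "q = (\<lambda>u. \<Prod>r = 1..K. u - c r)"
  define Q where "Q = (\<lambda>t h j. integral {t0 + real j * h..t0 + real j * h + h}
                         (\<lambda>s. v t s * q ((s - (t0 + real j * h)) / h)))"
  have cF: "continuous_on S F" for S
    unfolding F_def by (intro continuous_on_compose2[OF continuous_on_mittag_leffler[OF \<alpha>]] continuous_intros) auto
  have vint: "v t absolutely_integrable_on {t0..t}" if "t0 < t" for t
    unfolding v_def using that \<alpha> cF by (intro powr_kernel_absolutely_integrable) auto
  have cq: "continuous_on UNIV q" unfolding q_def by (intro continuous_intros)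
  have bq: "\<bar>q u\<bar> \<le> 1" if "u \<in> {0..1}" for u
    \<comment> \<open>Each factor is a difference of two points of the unit interval.\<close>
    unfolding q_def abs_prod using that assms(5) by (intro prod_le_1) (force simp: abs_le_iff)
  \<comment> \<open>Shared by both claims: the initial-value terms of solution and method coincide
    at \<open>t\<close>, so only the error of the quadrature remains.\<close>
  have err: "\<exists>C1 C2. C1 \<ge> 0 \<and> C2 \<ge> 0 \<and> (\<forall>n>0. \<forall>h. h = (t - t0) / real n \<longrightarrow>
      \<bar>Y t - y h n\<bar> \<le> C1 * h ^ K * (\<Sum>j<n. \<bar>Q t h j\<bar>) + C2 * h ^ (K + 1))" if t: "t0 < t" "t \<le> T" for t
  proof -
    have A: "finite {1..K}" "{1..K} \<noteq> {}" "c ` {1..K} \<subseteq> {0..1}" "card {1..K} = K"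
      using assms(3,5) by auto
    have f: "Ck_on (card {1..K} + 1) f {t0..T}" using assms(4) by simp
    show ?thesis
    proof (rule composite_quadrature_error[OF A(1,2) assms(6) A(3) t f vint[OF t(1)]], unfold A(4), goal_cases)
      case C: (1 C1 C2)
      have "\<bar>Y t - y h n\<bar> \<le> C1 * h ^ K * (\<Sum>j<n. \<bar>Q t h j\<bar>) + C2 * h ^ (K + 1)"
        if n: "n > 0" and h: "h = (t - t0) / real n" for n h
      proof -
        have h0: "h > 0" and tn: "t = t0 + real n * h" using n t h by auto
        have w: "(\<Sum>r\<in>{1..K}. b h r (n - j) * c r ^ k) =
             integral {t0 + real j * h..t0 + real j * h + h} (\<lambda>s. v t s * ((s - (t0 + real j * h)) / h) ^ k)"
          if "j < n" "k < K" for j k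
        proof -
          \<comment> \<open>Seen from the interval starting at \<open>t0 + real j * h\<close>, the
            point \<open>t\<close> lies \<open>n - j\<close> steps ahead, which is the index of the
            weight.\<close>
          have "t = (t0 + real j * h) + real (n - j) * h"
            using that by (simp add: tn of_nat_diff algebra_simps)
          from ml_R_eq_integral[OF \<alpha> h0 _ this, of k lam] that h0 assms(7) show ?thesis
            by (simp add: v_def F_def)
        qed
        have "integral {t0..t} (\<lambda>s. ml_kernel \<alpha> \<alpha> (t - s) lam * f s) = integral {t0..t} (\<lambda>s. v t s * f s)"
          by (rule integral_spike[of "{t}"]) (auto simp: ml_kernel_pos v_def F_def)
        then have "Y t - y h n = integral {t0..t} (\<lambda>s. v t s * f s)
            - (\<Sum>j<n. \<Sum>r\<in>{1..K}. b h r (n - j) * f (t0 + real j * h + c r * h))"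
          by (simp add: Y_def y_def fde_solution_def quadrature_method_def tn)
        then show ?thesis using C(3)[OF n h w] by (simp add: Q_def q_def)
      qed
      then show ?case using C(1,2) by blast
    qed
  qed
  have "converges_with_order t0 T Y y (real K)"
  proof (rule converges_with_orderI)
    fix t assume t: "t0 < t" "t \<le> T"
    obtain C1 C2 where C: "C1 \<ge> 0" "C2 \<ge> 0" "\<And>n h. n > 0 \<Longrightarrow> h = (t - t0) / real n \<Longrightarrow>
      \<bar>Y t - y h n\<bar> \<le> C1 * h ^ K * (\<Sum>j<n. \<bar>Q t h j\<bar>) + C2 * h ^ (K + 1)"
      using err[OF t] by blast
    define W where "W = integral {t0..t} (\<lambda>s. \<bar>v t s\<bar>)"
    have "\<bar>Y t - y h n\<bar> \<le> (C1 * W + C2 * (t - t0)) * h powr real K"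
      if n: "n > 0" and h: "h = (t - t0) / real n" for n h
    proof -
      have h0: "h > 0" and tn: "t = t0 + real n * h" using n t h by auto
      have hL: "h \<le> t - t0" using n h t divide_left_mono[of 1 "real n" "t - t0"] by simp
      \<comment> \<open>The nodal polynomial is at most 1 in absolute value, so the moments sum to
        no more than the mass of the kernel.\<close>
      have "(\<Sum>j<n. \<bar>Q t h j\<bar>) \<le> (\<Sum>j<n. 1 * integral {t0 + real j * h..t0 + real j * h + h} (\<lambda>s. \<bar>v t s\<bar>))"
        unfolding Q_def
      proof (intro sum_mono abs_integral_mult_le)
        fix j assume "j \<in> {..<n}"
        then show "v t absolutely_integrable_on {t0 + real j * h..t0 + real j * h + h}"
          using absolutely_integrable_on_subinterval[OF vint[OF t(1)]] mesh_subset[of h j n t0] h0 tn by auto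
        show "continuous_on {t0 + real j * h..t0 + real j * h + h} (\<lambda>s. q ((s - (t0 + real j * h)) / h))"
          using h0 by (intro continuous_on_compose2[OF cq] continuous_intros) auto
        show "\<bar>q ((s - (t0 + real j * h)) / h)\<bar> \<le> 1" if "s \<in> {t0 + real j * h..t0 + real j * h + h}" for s
          using that h0 by (intro bq) (auto simp: field_simps)
      qed
      also have "\<dots> = W"
        unfolding W_def tn mult_1 using vint[OF t(1)] h0
        by (intro integral_sum_mesh) (auto simp: absolutely_integrable_on_def tn)
      finally have "C1 * h ^ K * (\<Sum>j<n. \<bar>Q t h j\<bar>) \<le> C1 * h ^ K * W"
        using C(1) h0 by (intro mult_left_mono) auto
      moreover have "C2 * h ^ (K + 1) \<le> C2 * (h ^ K * (t - t0))"
        using C(2) h0 hL by (intro mult_left_mono) (auto simp: mult.commute)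
      ultimately show ?thesis using C(3)[OF n h] h0 by (simp add: powr_realpow algebra_simps)
    qed
    then show "\<exists>C. \<forall>n>0. \<bar>Y t - y ((t - t0) / real n) n\<bar> \<le> C * ((t - t0) / real n) powr real K"
      by blast
  qed
  moreover have "converges_with_order t0 T Y y (real K + min \<alpha> 1)" if P: "integral {0..1} q = 0"
  proof (rule converges_with_orderI)
    fix t assume t: "t0 < t" "t \<le> T"
    obtain C1 C2 where C: "C1 \<ge> 0" "C2 \<ge> 0" "\<And>n h. n > 0 \<Longrightarrow> h = (t - t0) / real n \<Longrightarrow>
      \<bar>Y t - y h n\<bar> \<le> C1 * h ^ K * (\<Sum>j<n. \<bar>Q t h j\<bar>) + C2 * h ^ (K + 1)"
      using err[OF t] by blast
    obtain B \<Lambda> where F: "\<Lambda> \<ge> 0" "\<And>x. x \<in> {0..(t - t0) powr \<alpha>} \<Longrightarrow> \<bar>F x\<bar> \<le> B"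
      "\<And>x y. x \<in> {0..(t - t0) powr \<alpha>} \<Longrightarrow> y \<in> {0..(t - t0) powr \<alpha>} \<Longrightarrow> \<bar>F x - F y\<bar> \<le> \<Lambda> * \<bar>x - y\<bar>"
      by (rule mittag_leffler_bounded_lipschitz[OF \<alpha>, of "(t - t0) powr \<alpha>" \<alpha> lam]) (rule that[unfolded F_def])
    obtain C3 where C3: "\<And>n h. n > 0 \<Longrightarrow> h = (t - t0) / real n \<Longrightarrow> (\<Sum>j<n. \<bar>Q t h j\<bar>) \<le> C3 * h powr min \<alpha> 1"
      by (rule zero_mean_moments_bound[OF \<alpha> t(1) F(2,1,3) cF cq bq P])
        (assumption | rule that[unfolded Q_def v_def], blast)+
    have "\<bar>Y t - y h n\<bar> \<le> (C1 * C3 + C2 * (t - t0) powr (1 - min \<alpha> 1)) * h powr (real K + min \<alpha> 1)"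
      if n: "n > 0" and h: "h = (t - t0) / real n" for n h
    proof -
      have h0: "h > 0" using n t h by auto
      have hL: "h \<le> t - t0" using n h t divide_left_mono[of 1 "real n" "t - t0"] by simp
      \<comment> \<open>The sum of the moments now supplies the extra factor
        \<open>h powr min \<alpha> 1\<close>.\<close>
      have "C1 * h ^ K * (\<Sum>j<n. \<bar>Q t h j\<bar>) \<le> C1 * h ^ K * (C3 * h powr min \<alpha> 1)"
        using C(1) h0 C3[OF n h] by (intro mult_left_mono) auto
      also have "\<dots> = C1 * C3 * h powr (real K + min \<alpha> 1)"
        using h0 by (simp add: powr_add powr_realpow)
      finally show ?thesis
        using C(3)[OF n h] mult_left_mono[OF powr_absorb_power[OF h0 hL, of "min \<alpha> 1" K] C(2)]
        by (simp add: algebra_simps)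
    qed
    then show "\<exists>C. \<forall>n>0. \<bar>Y t - y ((t - t0) / real n) n\<bar> \<le> C * ((t - t0) / real n) powr (real K + min \<alpha> 1)"
      by blast
  qed
  ultimately show ?thesis unfolding Y_def y_def q_def by blast
qed

end
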